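(* The constants $K_{2,q,p}$ for $q,p\in\{1,\infty\}$ are $$ K_{2,1,1}=2+2\sqrt2,\qquad K_{2,1,\infty}=1+\sqrt2,\qquad K_{2,\infty,1}=4,\qquad K_{2,\infty,\infty}=1 . $$ Moreover, extremal polynomials (i.e. nonzero $P\in\mathcal P(^2\mathbb R^2)$ with $|P|_q=K_{2,q,p}\|P\|_p$) are given by the following list, for every choice of (independent) signs: - for $q=p=1$: $\pm\frac{\sqrt2}{2}(x^2-y^2)+(2+\sqrt2)xy$; - for $q=1$, $p=\infty$: $\pm\left(\frac{2+\sqrt2}{4}x^2-\frac{2+\sqrt2}{4}y^2\pm\frac{\sqrt2}{2}xy\right)$; - for $q=\infty$, $p=1$: $\pm4xy$; - for $q=p=\infty$: $\pm x^2$, $\pm y^2$, and $\pm\left(\frac12x^2-\frac12y^2\pm xy\right)$.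
   Context: $\mathcal P(^2\mathbb R^2)$ is the real vector space of $2$-homogeneous polynomials $P(x,y)=ax^2+bxy+cy^2$ with $a,b,c\in\mathbb R$. For $1\le q<\infty$, $|P|_q=(|a|^q+|b|^q+|c|^q)^{1/q}$, and $|P|_\infty=\max\{|a|,|b|,|c|\}$. For $1\le p\le\infty$, $\|P\|_p=\sup\{|P(x,y)|:\ \|(x,y)\|_{\ell_p^2}\le 1\}$, where $\|(x,y)\|_{\ell_p^2}=(|x|^p+|y|^p)^{1/p}$ for $p<\infty$ and $\max\{|x|,|y|\}$ for $p=\infty$. The constant $K_{2,q,p}$ is the smallest $K>0$ such that $|P|_q\le K\|P\|_p$ for all $P\in\mathcal P(^2\mathbb R^2)$. The listed extremal polynomials are not claimed to be exhaustive. *)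

theory Defs
  imports "HOL-Library.Extended_Real"
begin

text \<open>
  A 2-homogeneous polynomial \<open>a x\<^sup>2 + b x y + c y\<^sup>2\<close> is represented by its
  coefficients, so \<open>Quad a b c\<close> ranges over the whole space. Exponents \<open>1 \<le> p \<le> \<infinity>\<close>
  are extended reals.
\<close>

datatype quad = Quad (coeff_xx: real) (coeff_xy: real) (coeff_yy: real)

definition quad_zero :: quad where
  "quad_zero = Quad 0 0 0"

fun quad_eval :: "quad \<Rightarrow> real \<times> real \<Rightarrow> real" where
  "quad_eval (Quad a b c) (x, y) = a * x\<^sup>2 + b * x * y + c * y\<^sup>2"

definition coeff_norm :: "ereal \<Rightarrow> quad \<Rightarrow> real" where
  "coeff_norm q P =
    (if q = \<infinity> then Max {\<bar>coeff_xx P\<bar>, \<bar>coeff_xy P\<bar>, \<bar>coeff_yy P\<bar>}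
     else (\<bar>coeff_xx P\<bar> powr real_of_ereal q + \<bar>coeff_xy P\<bar> powr real_of_ereal q
           + \<bar>coeff_yy P\<bar> powr real_of_ereal q) powr (1 / real_of_ereal q))"

fun lp_norm :: "ereal \<Rightarrow> real \<times> real \<Rightarrow> real" where
  "lp_norm p (x, y) =
    (if p = \<infinity> then max \<bar>x\<bar> \<bar>y\<bar>
     else (\<bar>x\<bar> powr real_of_ereal p + \<bar>y\<bar> powr real_of_ereal p) powr (1 / real_of_ereal p))"

definition sup_norm :: "ereal \<Rightarrow> quad \<Rightarrow> real" where
  "sup_norm p P = (SUP z\<in>{z. lp_norm p z \<le> 1}. \<bar>quad_eval P z\<bar>)"

definition admissible_const :: "ereal \<Rightarrow> ereal \<Rightarrow> real \<Rightarrow> bool" where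
  "admissible_const q p K \<longleftrightarrow> K > 0 \<and> (\<forall>P. coeff_norm q P \<le> K * sup_norm p P)"

definition K2 :: "ereal \<Rightarrow> ereal \<Rightarrow> real" where
  "K2 q p = (LEAST K. admissible_const q p K)"

definition extremal :: "ereal \<Rightarrow> ereal \<Rightarrow> quad \<Rightarrow> bool" where
  "extremal q p P \<longleftrightarrow> P \<noteq> quad_zero \<and> coeff_norm q P = K2 q p * sup_norm p P"

text \<open>
  The supremum and the least constant above are genuine: the supremum is over a nonempty bounded
  set, and the least admissible constant exists for all \<open>1 \<le> q, p \<le> \<infinity>\<close>
  (lemmas \<open>bdd_sup_norm\<close>, \<open>K2_admissible\<close> and \<open>K2_le\<close>).
\<close>

lemma exponent_cases:
  fixes p :: ereal
  assumes "1 \<le> p"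
  obtains "p = \<infinity>" | r where "p = ereal r" "1 \<le> r"
  using assms by (cases p) auto

lemma lp_ball_coords:
  assumes "1 \<le> p" "lp_norm p (x, y) \<le> 1"
  shows "\<bar>x\<bar> \<le> 1" "\<bar>y\<bar> \<le> 1"
proof -
  have aux: "\<bar>u\<bar> \<le> 1" if "1 \<le> r" "(\<bar>u\<bar> powr r + \<bar>v\<bar> powr r) powr (1 / r) \<le> 1" for u v r :: real
  proof -
    have "\<bar>u\<bar> = (\<bar>u\<bar> powr r) powr (1 / r)"
      using that(1) by (simp add: powr_powr)
    also have "\<dots> \<le> (\<bar>u\<bar> powr r + \<bar>v\<bar> powr r) powr (1 / r)"
      using that(1) by (intro powr_mono2) auto
    finally show ?thesis using that(2) by simp
  qed
  have "\<bar>x\<bar> \<le> 1 \<and> \<bar>y\<bar> \<le> 1"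
    using assms(1)
  proof (cases rule: exponent_cases)
    case 1
    then show ?thesis using assms(2) by auto
  next
    case (2 r)
    then show ?thesis
      using assms(2) aux[of r x y] aux[of r y x] by (auto simp: add.commute)
  qed
  then show "\<bar>x\<bar> \<le> 1" "\<bar>y\<bar> \<le> 1" by auto
qed

lemma quad_eval_bound:
  assumes "\<bar>x\<bar> \<le> 1" "\<bar>y\<bar> \<le> 1"
  shows "\<bar>quad_eval (Quad a b c) (x, y)\<bar> \<le> \<bar>a\<bar> + \<bar>b\<bar> + \<bar>c\<bar>"
proof -
  have *: "\<bar>k * (u * v)\<bar> \<le> \<bar>k\<bar>" if "\<bar>u\<bar> \<le> 1" "\<bar>v\<bar> \<le> 1" for k u v :: real
  proof -
    have "\<bar>u\<bar> * \<bar>v\<bar> \<le> 1 * 1" using that by (intro mult_mono) auto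
    then show ?thesis by (simp add: abs_mult mult_left_le)
  qed
  show ?thesis
    using *[OF assms(1) assms(1), of a] *[OF assms, of b] *[OF assms(2) assms(2), of c]
    unfolding quad_eval.simps power2_eq_square mult.assoc by linarith
qed

lemma bdd_sup_norm:
  assumes "1 \<le> p"
  shows "bdd_above ((\<lambda>z. \<bar>quad_eval P z\<bar>) ` {z. lp_norm p z \<le> 1})"
proof (cases P)
  case (Quad a b c)
  show ?thesis
  proof (rule bdd_aboveI2)
    fix z :: "real \<times> real"
    assume z: "z \<in> {z. lp_norm p z \<le> 1}"
    obtain x y where "z = (x, y)" by (cases z)
    then show "\<bar>quad_eval P z\<bar> \<le> \<bar>a\<bar> + \<bar>b\<bar> + \<bar>c\<bar>"
      using z lp_ball_coords[OF assms, of x y] quad_eval_bound[of x y a b c] Quad by simp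
  qed
qed

lemma sup_norm_upper:
  assumes "1 \<le> p" "lp_norm p z \<le> 1"
  shows "\<bar>quad_eval P z\<bar> \<le> sup_norm p P"
  unfolding sup_norm_def by (rule cSUP_upper) (use assms bdd_sup_norm in auto)

lemma lp_ball_points:
  assumes "1 \<le> p"
  shows "lp_norm p (1, 0) \<le> 1" "lp_norm p (0, 1) \<le> 1"
    "lp_norm p (1/2, 1/2) \<le> 1" "lp_norm p (1/2, -(1/2)) \<le> 1"
proof -
  have half: "((1/2) powr r + (1/2) powr r) powr (1 / r) \<le> 1" if "1 \<le> r" for r :: real
  proof -
    have "(1/2 :: real) powr r \<le> (1/2) powr 1"
      using that by (intro powr_mono') auto
    then have "((1/2) powr r + (1/2) powr r) powr (1 / r) \<le> (1::real) powr (1 / r)"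
      using that by (intro powr_mono2) auto
    then show ?thesis by simp
  qed
  show "lp_norm p (1, 0) \<le> 1" "lp_norm p (0, 1) \<le> 1"
    by auto
  show "lp_norm p (1/2, 1/2) \<le> 1" "lp_norm p (1/2, -(1/2)) \<le> 1"
    using assms half by (cases rule: exponent_cases; force)+
qed

lemma coeffs_le_sup_norm:
  assumes "1 \<le> p"
  shows "\<bar>a\<bar> + \<bar>b\<bar> + \<bar>c\<bar> \<le> 6 * sup_norm p (Quad a b c)"
proof -
  note up = sup_norm_upper[OF assms, of _ "Quad a b c"]
  show ?thesis
    using up[OF lp_ball_points(1)[OF assms]] up[OF lp_ball_points(2)[OF assms]]
      up[OF lp_ball_points(3)[OF assms]] up[OF lp_ball_points(4)[OF assms]]
    by (simp add: power2_eq_square)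
qed

lemma coeff_norm_le:
  assumes "1 \<le> q"
  shows "coeff_norm q (Quad a b c) \<le> 3 * (\<bar>a\<bar> + \<bar>b\<bar> + \<bar>c\<bar>)"
  using assms
proof (cases rule: exponent_cases)
  case 1
  then show ?thesis by (simp add: coeff_norm_def)
next
  case (2 r)
  define M where "M = \<bar>a\<bar> + \<bar>b\<bar> + \<bar>c\<bar>"
  have M0: "0 \<le> M" by (simp add: M_def)
  have "\<bar>a\<bar> powr r \<le> M powr r" "\<bar>b\<bar> powr r \<le> M powr r" "\<bar>c\<bar> powr r \<le> M powr r"
    using 2 by (auto intro!: powr_mono2 simp: M_def)
  then have "\<bar>a\<bar> powr r + \<bar>b\<bar> powr r + \<bar>c\<bar> powr r \<le> 3 * M powr r" by simp
  then have "coeff_norm q (Quad a b c) \<le> (3 * M powr r) powr (1 / r)"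
    using 2 by (auto simp: coeff_norm_def intro!: powr_mono2)
  also have "\<dots> = 3 powr (1 / r) * M"
    using 2 M0 by (simp add: powr_mult powr_powr)
  also have "\<dots> \<le> 3 powr 1 * M"
    using 2 M0 by (intro mult_right_mono powr_mono) auto
  finally show ?thesis by (simp add: M_def)
qed

lemma admissible_18:
  assumes "1 \<le> q" "1 \<le> p"
  shows "admissible_const q p 18"
  unfolding admissible_const_def
proof (intro conjI allI)
  fix P
  obtain a b c where "P = Quad a b c" by (cases P)
  then show "coeff_norm q P \<le> 18 * sup_norm p P"
    using coeff_norm_le[OF assms(1), of a b c] coeffs_le_sup_norm[OF assms(2), of a b c] by simp
qed simp

lemma admissible_ge_1:
  assumes "1 \<le> q" "1 \<le> p" "admissible_const q p K"
  shows "1 \<le> K"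
proof -
  have "coeff_norm q (Quad 1 0 0) = 1"
    using assms(1) by (cases rule: exponent_cases) (auto simp: coeff_norm_def)
  moreover have "sup_norm p (Quad 1 0 0) \<le> 1"
    unfolding sup_norm_def
  proof (rule cSUP_least)
    show "{z. lp_norm p z \<le> 1} \<noteq> {}" using lp_ball_points(1)[OF assms(2)] by blast
    fix z assume z: "z \<in> {z. lp_norm p z \<le> 1}"
    obtain x y where "z = (x, y)" by (cases z)
    then show "\<bar>quad_eval (Quad 1 0 0) z\<bar> \<le> 1"
      using z lp_ball_coords[OF assms(2), of x y] quad_eval_bound[of x y 1 0 0] by simp
  qed
  then have "K * sup_norm p (Quad 1 0 0) \<le> K * 1"
    using assms(3) by (intro mult_left_mono) (auto simp: admissible_const_def)
  ultimately show ?thesis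
    using assms(3) unfolding admissible_const_def by (metis mult.right_neutral order_trans)
qed

lemma K2_least:
  assumes "1 \<le> q" "1 \<le> p"
  shows "admissible_const q p (K2 q p) \<and> (\<forall>K. admissible_const q p K \<longrightarrow> K2 q p \<le> K)"
proof -
  define S where "S = {K. admissible_const q p K}"
  have ne: "S \<noteq> {}" using admissible_18[OF assms] by (auto simp: S_def)
  have bdd: "bdd_below S"
    using admissible_ge_1[OF assms] by (intro bdd_belowI[of _ 1]) (auto simp: S_def)
  have lower: "Inf S \<le> K" if "admissible_const q p K" for K
    using that bdd by (intro cInf_lower) (auto simp: S_def)
  have "1 \<le> Inf S"
    using ne admissible_ge_1[OF assms] by (intro cInf_greatest) (auto simp: S_def)
  moreover have "coeff_norm q P \<le> Inf S * sup_norm p P" for P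
  proof (cases "sup_norm p P > 0")
    case True
    have "coeff_norm q P / sup_norm p P \<le> Inf S"
      using ne True
      by (intro cInf_greatest) (auto simp: S_def admissible_const_def divide_simps)
    then show ?thesis using True by (simp add: divide_simps)
  next
    case False
    have "0 \<le> sup_norm p P"
      using sup_norm_upper[OF assms(2) lp_ball_points(1)[OF assms(2)], of P] by linarith
    with False have "sup_norm p P = 0" by simp
    then show ?thesis
      using admissible_18[OF assms] by (metis admissible_const_def mult_zero_right)
  qed
  ultimately have adm: "admissible_const q p (Inf S)" by (simp add: admissible_const_def)
  then have "K2 q p = Inf S"
    unfolding K2_def by (intro Least_equality) (auto intro: lower)
  then show ?thesis using adm lower by simp
qed

lemmas K2_admissible = K2_least[THEN conjunct1]

lemma K2_le: "1 \<le> q \<Longrightarrow> 1 \<le> p \<Longrightarrow> admissible_const q p K \<Longrightarrow> K2 q p \<le> K"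
  using K2_least by blast

end

theory Submission
  imports Defs
begin

text \<open>
  Every constant comes from a matching pair: finitely many points of the unit ball bound the
  coefficients from above, and a polynomial of norm at most one attains that bound.

  For the maximal coefficient the points are the two coordinate vectors and the diagonal points
  \<open>(t, \<plusminus>t)\<close>: the former see the square coefficients, and half the difference of
  the values at the latter is the mixed one, scaled by \<open>t\<^sup>2\<close>.

  For the sum of the coefficients, the diagonal points suffice when \<open>a\<close> and \<open>c\<close> have the
  same sign. When the signs differ, \<open>\<bar>a\<bar> + \<bar>c\<bar> = \<bar>a - c\<bar>\<close>, and this combination
  is seen by subtracting the values at a point \<open>(x, y)\<close> and at its rotation \<open>(y, -x)\<close>:
  the difference is \<open>(a - c) (x\<^sup>2 - y\<^sup>2) + 2 b x y\<close>. Choosing the direction with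
  \<open>x\<^sup>2 - y\<^sup>2 = 2 x y\<close>, that is at angle \<open>\<pi>/8\<close>, weights \<open>a - c\<close> and \<open>b\<close> equally,
  so that all three coefficients are measured at once (\<open>coeff_sum_le\<close>). The numbers
  \<open>1 + \<surd>2\<close> and \<open>2 + 2\<surd>2\<close> are \<open>1 / (x y)\<close> for the point of the respective unit
  sphere in this direction.

  Except for \<open>\<plusminus>x\<^sup>2\<close> and \<open>\<plusminus>y\<^sup>2\<close>, all listed polynomials have the form
  \<open>a x\<^sup>2 + b x y - a y\<^sup>2\<close>, and \<open>a, b \<ge> 0\<close> may be assumed
  by reflecting and exchanging the coordinates. Their norm is at most one because the square of the
  \<open>\<ell>\<^sub>p\<close> norm minus the polynomial is, on the critical part of the first quadrant (all of it
  for \<open>p = 1\<close>, the half \<open>y \<le> x\<close> for \<open>p = \<infinity>\<close>), a binary quadratic form whose discriminant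
  is at most zero. In these examples the discriminant vanishes, so the form is a perfect square
  up to a positive factor.
\<close>

section \<open>Matching a test polynomial with an admissible constant\<close>

text \<open>
  Since \<open>K = coeff_norm q P \<le> K2 q p * sup_norm p P \<le> K2 q p \<le> K\<close>, equality holds
  throughout; one witness therefore settles both the constant and its own extremality.
\<close>

lemma K2_eq_and_extremal:
  assumes "1 \<le> q" "1 \<le> p" and adm: "admissible_const q p K"
    and coeff: "coeff_norm q P = K" and sup: "sup_norm p P \<le> 1"
  shows "K2 q p = K" "extremal q p P"
proof -
  have K: "K > 0" using adm by (simp add: admissible_const_def)
  have K2: "K2 q p > 0" "K \<le> K2 q p * sup_norm p P"
    using K2_admissible[OF assms(1,2)] coeff by (auto simp: admissible_const_def)
  have "K2 q p * sup_norm p P \<le> K2 q p"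
    using K2(1) sup by (simp add: mult_left_le)
  with K2(2) K2_le[OF assms(1,2) adm] show eq: "K2 q p = K" by linarith
  have "K * 1 \<le> K * sup_norm p P" using K2(2) eq by simp
  then have "sup_norm p P = 1" using K sup by simp
  moreover have "coeff_norm q quad_zero = 0"
    using assms(1) by (cases rule: exponent_cases) (auto simp: coeff_norm_def quad_zero_def)
  ultimately show "extremal q p P"
    using eq coeff K by (auto simp: extremal_def)
qed

lemma coeff_norm_1: "coeff_norm 1 (Quad a b c) = \<bar>a\<bar> + \<bar>b\<bar> + \<bar>c\<bar>"
  by (simp add: coeff_norm_def)

lemma coeff_norm_infinity: "coeff_norm \<infinity> (Quad a b c) = max \<bar>a\<bar> (max \<bar>b\<bar> \<bar>c\<bar>)"
  by (simp add: coeff_norm_def)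

lemma lp_norm_1: "lp_norm 1 (x, y) = \<bar>x\<bar> + \<bar>y\<bar>"
  by simp

lemma lp_norm_flip: "lp_norm p (x, -y) = lp_norm p (x, y)"
  by simp

lemma lp_norm_swap: "lp_norm p (y, x) = lp_norm p (x, y)"
  by (simp add: add.commute max.commute)

section \<open>Upper bounds from test points\<close>

lemma square_coeffs_le_sup_norm:
  assumes "1 \<le> p"
  shows "\<bar>a\<bar> \<le> sup_norm p (Quad a b c)"
    and "\<bar>c\<bar> \<le> sup_norm p (Quad a b c)"
  using sup_norm_upper[OF assms lp_ball_points(1)[OF assms], of "Quad a b c"]
    sup_norm_upper[OF assms lp_ball_points(2)[OF assms], of "Quad a b c"]
  by simp_all

lemma diagonal_le_sup_norm:
  assumes p: "1 \<le> p" and t: "lp_norm p (t, t) \<le> 1"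
  shows "t\<^sup>2 * (\<bar>a + c\<bar> + \<bar>b\<bar>) \<le> sup_norm p (Quad a b c)"
proof -
  have "lp_norm p (t, -t) \<le> 1" unfolding lp_norm_flip by (fact t)
  then have "\<bar>t\<^sup>2 * (a + c + b)\<bar> \<le> sup_norm p (Quad a b c)"
    "\<bar>t\<^sup>2 * (a + c - b)\<bar> \<le> sup_norm p (Quad a b c)"
    using sup_norm_upper[OF p t, of "Quad a b c"] sup_norm_upper[OF p, of "(t, -t)" "Quad a b c"]
    by (simp_all add: algebra_simps power2_eq_square)
  moreover have "\<bar>a + c\<bar> + \<bar>b\<bar> = max \<bar>a + c + b\<bar> \<bar>a + c - b\<bar>" by linarith
  ultimately show ?thesis by (auto simp: abs_mult max_def)
qed

lemma mixed_coeff_le_sup_norm: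
  assumes "1 \<le> p" "lp_norm p (t, t) \<le> 1"
  shows "t\<^sup>2 * \<bar>b\<bar> \<le> sup_norm p (Quad a b c)"
proof -
  have "t\<^sup>2 * \<bar>b\<bar> \<le> t\<^sup>2 * (\<bar>a + c\<bar> + \<bar>b\<bar>)" by (intro mult_left_mono) auto
  with diagonal_le_sup_norm[OF assms, of a c b] show ?thesis by linarith
qed

text \<open>
  The hypothesis \<open>x\<^sup>2 - y\<^sup>2 = 2 x y\<close> makes \<open>a - c\<close> and \<open>b\<close> enter with the same
  weight in \<open>P(x, y) - P(y, -x)\<close>, which measures \<open>\<bar>a\<bar> + \<bar>b\<bar> + \<bar>c\<bar>\<close> when \<open>a\<close> and
  \<open>c\<close> have opposite signs. For equal signs the diagonal point \<open>(t, t)\<close> gives the stronger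
  factor \<open>t\<^sup>2\<close>.
\<close>

lemma coeff_sum_le:
  assumes p: "1 \<le> p" and t: "lp_norm p (t, t) \<le> 1" and xy: "lp_norm p (x, y) \<le> 1"
    and dir: "x\<^sup>2 - y\<^sup>2 = 2 * x * y" and pos: "0 \<le> x * y" and le: "x * y \<le> t\<^sup>2"
  shows "x * y * (\<bar>a\<bar> + \<bar>b\<bar> + \<bar>c\<bar>) \<le> sup_norm p (Quad a b c)"
proof (cases "0 \<le> a * c")
  case True
  then have "\<bar>a + c\<bar> = \<bar>a\<bar> + \<bar>c\<bar>" by (auto simp: zero_le_mult_iff)
  then have "t\<^sup>2 * (\<bar>a\<bar> + \<bar>b\<bar> + \<bar>c\<bar>) \<le> sup_norm p (Quad a b c)"
    using diagonal_le_sup_norm[OF p t, of a c b] by (simp add: algebra_simps)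
  moreover have "x * y * (\<bar>a\<bar> + \<bar>b\<bar> + \<bar>c\<bar>) \<le> t\<^sup>2 * (\<bar>a\<bar> + \<bar>b\<bar> + \<bar>c\<bar>)"
    using le by (intro mult_right_mono) auto
  ultimately show ?thesis by linarith
next
  case False
  define N where "N = sup_norm p (Quad a b c)"
  have xy': "lp_norm p (x, -y) \<le> 1" unfolding lp_norm_flip by (fact xy)
  have yx: "lp_norm p (y, x) \<le> 1" using xy lp_norm_swap by metis
  have yx': "lp_norm p (y, -x) \<le> 1" unfolding lp_norm_flip by (fact yx)
  note up = sup_norm_upper[OF p, of _ "Quad a b c", folded N_def]
  have "quad_eval (Quad a b c) (x, y) - quad_eval (Quad a b c) (y, -x)
      = (a - c) * (x\<^sup>2 - y\<^sup>2) + 2 * b * x * y"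
    by (simp add: algebra_simps)
  then have 1: "quad_eval (Quad a b c) (x, y) - quad_eval (Quad a b c) (y, -x)
      = 2 * (x * y * (a - c + b))"
    unfolding dir by (simp add: algebra_simps)
  have "quad_eval (Quad a b c) (x, -y) - quad_eval (Quad a b c) (y, x)
      = (a - c) * (x\<^sup>2 - y\<^sup>2) - 2 * b * x * y"
    by (simp add: algebra_simps)
  then have 2: "quad_eval (Quad a b c) (x, -y) - quad_eval (Quad a b c) (y, x)
      = 2 * (x * y * (a - c - b))"
    unfolding dir by (simp add: algebra_simps)
  have "\<bar>x * y * (a - c + b)\<bar> \<le> N" "\<bar>x * y * (a - c - b)\<bar> \<le> N"
    using 1 up[OF xy] up[OF yx'] 2 up[OF xy'] up[OF yx] by linarith+
  then have "x * y * \<bar>a - c + b\<bar> \<le> N" "x * y * \<bar>a - c - b\<bar> \<le> N"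
    using pos by (simp_all only: abs_mult[of "x * y"] abs_of_nonneg)
  moreover have "\<bar>a\<bar> + \<bar>b\<bar> + \<bar>c\<bar> = max \<bar>a - c + b\<bar> \<bar>a - c - b\<bar>"
    using False by (auto simp: not_le mult_less_0_iff)
  ultimately show ?thesis by (auto simp: N_def max_def)
qed

lemma admissible_1_1: "admissible_const 1 1 (2 + 2 * sqrt 2)"
  unfolding admissible_const_def
proof (intro conjI allI)
  show "0 < 2 + 2 * sqrt 2" by (simp add: add_pos_pos)
  fix P obtain a b c where P: "P = Quad a b c" by (cases P)
  define x y where "x = sqrt 2 / 2" and "y = 1 - sqrt 2 / 2"
  have s: "sqrt 2 * sqrt 2 = 2" "1 \<le> sqrt 2" "sqrt 2 \<le> 3 / 2"
    by (simp, simp, rule real_le_lsqrt) (simp_all add: power2_eq_square)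
  have prod: "x * y = (sqrt 2 - 1) / 2" using s by (simp add: x_def y_def field_simps)
  have "x * y * (\<bar>a\<bar> + \<bar>b\<bar> + \<bar>c\<bar>) \<le> sup_norm 1 P"
    unfolding P
  proof (rule coeff_sum_le[where t = "1/2"])
    show "lp_norm 1 (1/2, 1/2) \<le> 1" by (simp add: lp_norm_1 del: lp_norm.simps)
    show "lp_norm 1 (x, y) \<le> 1"
      using s by (simp add: lp_norm_1 x_def y_def del: lp_norm.simps)
    show "x\<^sup>2 - y\<^sup>2 = 2 * x * y"
      using s by (simp add: x_def y_def power2_eq_square algebra_simps)
    show "0 \<le> x * y" using s by (simp add: prod)
    show "x * y \<le> (1/2)\<^sup>2" using s by (simp add: prod power2_eq_square)
  qed simp
  then have "(2 + 2 * sqrt 2) * (x * y * (\<bar>a\<bar> + \<bar>b\<bar> + \<bar>c\<bar>)) \<le> (2 + 2 * sqrt 2) * sup_norm 1 P"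
    by (intro mult_left_mono) auto
  moreover have "(2 + 2 * sqrt 2) * (x * y) = 1" using s(1) by (simp add: prod field_simps)
  ultimately show "coeff_norm 1 P \<le> (2 + 2 * sqrt 2) * sup_norm 1 P"
    unfolding P coeff_norm_1 mult.assoc[symmetric] by simp
qed

lemma admissible_1_infinity: "admissible_const 1 \<infinity> (1 + sqrt 2)"
  unfolding admissible_const_def
proof (intro conjI allI)
  show "0 < 1 + sqrt 2" by (simp add: add_pos_pos)
  fix P obtain a b c where P: "P = Quad a b c" by (cases P)
  define y where "y = sqrt 2 - 1"
  have s: "sqrt 2 * sqrt 2 = 2" "1 \<le> sqrt 2" "sqrt 2 \<le> 2"
    by (auto intro!: real_le_lsqrt simp: power2_eq_square)
  have "1 * y * (\<bar>a\<bar> + \<bar>b\<bar> + \<bar>c\<bar>) \<le> sup_norm \<infinity> P"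
    unfolding P
  proof (rule coeff_sum_le[where t = 1])
    show "1\<^sup>2 - y\<^sup>2 = 2 * 1 * y"
      using s by (simp add: y_def power2_eq_square algebra_simps)
  qed (use s in \<open>auto simp: y_def\<close>)
  then have "(1 + sqrt 2) * (y * (\<bar>a\<bar> + \<bar>b\<bar> + \<bar>c\<bar>)) \<le> (1 + sqrt 2) * sup_norm \<infinity> P"
    by (intro mult_left_mono) auto
  moreover have "(1 + sqrt 2) * y = 1" using s by (simp add: y_def algebra_simps)
  ultimately show "coeff_norm 1 P \<le> (1 + sqrt 2) * sup_norm \<infinity> P"
    unfolding P coeff_norm_1 mult.assoc[symmetric] by simp
qed

lemma admissible_infinity_1: "admissible_const \<infinity> 1 4"
  unfolding admissible_const_def
proof (intro conjI allI)
  fix P obtain a b c where P: "P = Quad a b c" by (cases P)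
  have "lp_norm 1 (1/2, 1/2) \<le> 1" by (simp add: lp_norm_1 del: lp_norm.simps)
  then have "(1/2)\<^sup>2 * \<bar>b\<bar> \<le> sup_norm 1 P"
    unfolding P by (intro mixed_coeff_le_sup_norm) auto
  then show "coeff_norm \<infinity> P \<le> 4 * sup_norm 1 P"
    using square_coeffs_le_sup_norm(1)[of 1 a b c] square_coeffs_le_sup_norm(2)[of 1 c a b]
    by (auto simp: P coeff_norm_infinity power2_eq_square)
qed simp

lemma admissible_infinity_infinity: "admissible_const \<infinity> \<infinity> 1"
  unfolding admissible_const_def
proof (intro conjI allI)
  fix P obtain a b c where P: "P = Quad a b c" by (cases P)
  have "1\<^sup>2 * \<bar>b\<bar> \<le> sup_norm \<infinity> P"
    unfolding P by (intro mixed_coeff_le_sup_norm) auto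
  then show "coeff_norm \<infinity> P \<le> 1 * sup_norm \<infinity> P"
    using square_coeffs_le_sup_norm(1)[of \<infinity> a b c]
      square_coeffs_le_sup_norm(2)[of \<infinity> c a b]
    by (simp add: P coeff_norm_infinity)
qed simp

section \<open>Norms of the extremal polynomials\<close>

lemma binary_form_nonneg:
  fixes A B C u v :: real
  assumes "0 \<le> A" "0 \<le> C" "B\<^sup>2 \<le> 4 * A * C"
  shows "0 \<le> A * u\<^sup>2 + B * u * v + C * v\<^sup>2"
proof (cases "A = 0")
  case True
  then show ?thesis using assms by simp
next
  case False
  have "0 \<le> (2 * A * u + B * v)\<^sup>2 + (4 * A * C - B\<^sup>2) * v\<^sup>2"
    using assms by simp
  also have "\<dots> = 4 * A * (A * u\<^sup>2 + B * u * v + C * v\<^sup>2)"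
    by (simp add: power2_eq_square algebra_simps)
  finally show ?thesis using False assms(1) by (simp add: zero_le_mult_iff)
qed

text \<open>
  Reflecting a coordinate turns \<open>b\<close> into \<open>-b\<close>, exchanging the coordinates turns \<open>a\<close> into
  \<open>-a\<close>, and neither changes the norm. Hence only nonnegative coefficients and the quadrant
  \<open>u, v \<ge> 0\<close> have to be tested. The function \<open>n\<close> stands for the square of the \<open>\<ell>\<^sub>p\<close>
  norm on that quadrant.
\<close>

lemma sup_norm_antisymmetric_le:
  assumes ball: "\<And>x y. lp_norm p (x, y) \<le> 1 \<Longrightarrow> n \<bar>x\<bar> \<bar>y\<bar> \<le> 1"
    and sym: "\<And>u v. n u v = n v u"
    and bound: "\<And>u v. 0 \<le> u \<Longrightarrow> 0 \<le> v \<Longrightarrow> \<bar>a\<bar> * (u\<^sup>2 - v\<^sup>2) + \<bar>b\<bar> * u * v \<le> n u v"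
    and p: "1 \<le> p"
  shows "sup_norm p (Quad a b (-a)) \<le> 1"
  unfolding sup_norm_def
proof (rule cSUP_least)
  show "{z. lp_norm p z \<le> 1} \<noteq> {}" using lp_ball_points(1)[OF p] by blast
  fix z assume "z \<in> {z. lp_norm p z \<le> 1}"
  then obtain x y where z: "z = (x, y)" "lp_norm p (x, y) \<le> 1" by (cases z) auto
  have "quad_eval (Quad a b (-a)) z = a * (\<bar>x\<bar>\<^sup>2 - \<bar>y\<bar>\<^sup>2) + b * (x * y)"
    by (simp add: z(1) algebra_simps)
  then have "\<bar>quad_eval (Quad a b (-a)) z\<bar> \<le> \<bar>a\<bar> * \<bar>\<bar>x\<bar>\<^sup>2 - \<bar>y\<bar>\<^sup>2\<bar> + \<bar>b\<bar> * \<bar>x\<bar> * \<bar>y\<bar>"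
    using abs_triangle_ineq[of "a * (\<bar>x\<bar>\<^sup>2 - \<bar>y\<bar>\<^sup>2)" "b * (x * y)"]
    by (simp add: abs_mult mult.assoc)
  also have "\<dots> \<le> n \<bar>x\<bar> \<bar>y\<bar>"
  proof (cases "0 \<le> \<bar>x\<bar>\<^sup>2 - \<bar>y\<bar>\<^sup>2")
    case True
    then show ?thesis using bound[of "\<bar>x\<bar>" "\<bar>y\<bar>"] by (simp only: abs_of_nonneg abs_ge_zero)
  next
    case False
    then have "\<bar>\<bar>x\<bar>\<^sup>2 - \<bar>y\<bar>\<^sup>2\<bar> = \<bar>y\<bar>\<^sup>2 - \<bar>x\<bar>\<^sup>2" by linarith
    then show ?thesis using bound[of "\<bar>y\<bar>" "\<bar>x\<bar>"] sym[of "\<bar>x\<bar>" "\<bar>y\<bar>"]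
      by (simp only: abs_ge_zero mult.commute mult.left_commute)
  qed
  also have "\<dots> \<le> 1" using ball z(2) .
  finally show "\<bar>quad_eval (Quad a b (-a)) z\<bar> \<le> 1" .
qed

text \<open>
  The hypothesis bounds the discriminant of \<open>(u + v)\<^sup>2 - \<bar>a\<bar> (u\<^sup>2 - v\<^sup>2) - \<bar>b\<bar> u v\<close>.
\<close>

lemma sup_norm_1_antisymmetric_le:
  assumes disc: "(2 - \<bar>b\<bar>)\<^sup>2 \<le> 4 * (1 - a\<^sup>2)"
  shows "sup_norm 1 (Quad a b (-a)) \<le> 1"
proof (rule sup_norm_antisymmetric_le[where n = "\<lambda>u v. (u + v)\<^sup>2"])
  have "0 \<le> (2 - \<bar>b\<bar>)\<^sup>2" by simp
  with disc have "0 \<le> 4 * (1 - a\<^sup>2)" by linarith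
  then have "a\<^sup>2 \<le> 1" by simp
  then have a: "\<bar>a\<bar> \<le> 1" by (simp add: abs_square_le_1)
  fix u v :: real
  have "4 * (1 - \<bar>a\<bar>) * (1 + \<bar>a\<bar>) = 4 * (1 - \<bar>a\<bar>\<^sup>2)" by (simp add: algebra_simps power2_eq_square)
  then have "0 \<le> (1 - \<bar>a\<bar>) * u\<^sup>2 + (2 - \<bar>b\<bar>) * u * v + (1 + \<bar>a\<bar>) * v\<^sup>2"
    using a disc by (intro binary_form_nonneg) auto
  then show "\<bar>a\<bar> * (u\<^sup>2 - v\<^sup>2) + \<bar>b\<bar> * u * v \<le> (u + v)\<^sup>2"
    by (simp add: algebra_simps power2_eq_square)
next
  fix x y assume "lp_norm 1 (x, y) \<le> 1"
  then show "(\<bar>x\<bar> + \<bar>y\<bar>)\<^sup>2 \<le> 1" by (simp add: abs_square_le_1)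
qed (auto simp: add.commute)

text \<open>
  The hypothesis bounds the discriminant of \<open>u\<^sup>2 - \<bar>a\<bar> (u\<^sup>2 - v\<^sup>2) - \<bar>b\<bar> u v\<close>, which
  settles \<open>v \<le> u\<close>. It also forces \<open>\<bar>b\<bar> \<le> 1\<close>, and that is enough for \<open>u < v\<close>, where the
  term with \<open>\<bar>a\<bar>\<close> is negative.
\<close>

lemma sup_norm_infinity_antisymmetric_le:
  assumes disc: "b\<^sup>2 \<le> 4 * (1 - \<bar>a\<bar>) * \<bar>a\<bar>"
  shows "sup_norm \<infinity> (Quad a b (-a)) \<le> 1"
proof (rule sup_norm_antisymmetric_le[where n = "\<lambda>u v. (max u v)\<^sup>2"])
  have "0 \<le> 4 * (1 - \<bar>a\<bar>) * \<bar>a\<bar>" using disc zero_le_power2[of b] by linarith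
  then have a: "\<bar>a\<bar> \<le> 1" by (auto simp: zero_le_mult_iff)
  have "4 * (1 - \<bar>a\<bar>) * \<bar>a\<bar> = 1 - (2 * \<bar>a\<bar> - 1)\<^sup>2"
    by (simp add: power2_eq_square algebra_simps)
  also have "\<dots> \<le> 1" by simp
  finally have "b\<^sup>2 \<le> 1" using disc by linarith
  then have b: "\<bar>b\<bar> \<le> 1" by (simp add: abs_square_le_1)
  fix u v :: real assume uv: "0 \<le> u" "0 \<le> v"
  show "\<bar>a\<bar> * (u\<^sup>2 - v\<^sup>2) + \<bar>b\<bar> * u * v \<le> (max u v)\<^sup>2"
  proof (cases "v \<le> u")
    case True
    have "0 \<le> (1 - \<bar>a\<bar>) * u\<^sup>2 + (- \<bar>b\<bar>) * u * v + \<bar>a\<bar> * v\<^sup>2"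
      using a disc by (intro binary_form_nonneg) auto
    then show ?thesis using True by (simp add: algebra_simps)
  next
    case False
    then have "u\<^sup>2 \<le> v\<^sup>2" using uv by (intro power_mono) auto
    then have "\<bar>a\<bar> * (u\<^sup>2 - v\<^sup>2) \<le> 0" by (simp add: mult_nonneg_nonpos)
    moreover have "\<bar>b\<bar> * u * v \<le> 1 * v * v"
      using uv b False by (intro mult_mono) auto
    ultimately show ?thesis using False by (simp add: power2_eq_square)
  qed
next
  fix x y assume "lp_norm \<infinity> (x, y) \<le> 1"
  then show "(max \<bar>x\<bar> \<bar>y\<bar>)\<^sup>2 \<le> 1" by (intro power_le_one) (auto simp: le_max_iff_disj)
qed (auto simp: max.commute)

lemma sup_norm_le_coeff_sum:
  assumes "1 \<le> p"
  shows "sup_norm p (Quad a b c) \<le> \<bar>a\<bar> + \<bar>b\<bar> + \<bar>c\<bar>"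
  unfolding sup_norm_def
proof (rule cSUP_least)
  show "{z. lp_norm p z \<le> 1} \<noteq> {}" using lp_ball_points(1)[OF assms] by blast
  fix z assume "z \<in> {z. lp_norm p z \<le> 1}"
  then obtain x y where z: "z = (x, y)" "lp_norm p (x, y) \<le> 1" by (cases z) auto
  show "\<bar>quad_eval (Quad a b c) z\<bar> \<le> \<bar>a\<bar> + \<bar>b\<bar> + \<bar>c\<bar>"
    unfolding z(1) by (rule quad_eval_bound[OF lp_ball_coords[OF assms z(2)]])
qed

section \<open>The constants and their extremal polynomials\<close>

lemma extremal_1_1:
  assumes "s \<in> {1, -1}"
  defines "P \<equiv> Quad (s * (sqrt 2 / 2)) (2 + sqrt 2) (- s * (sqrt 2 / 2))"
  shows "K2 1 1 = 2 + 2 * sqrt 2" "extremal 1 1 P"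
proof -
  have s2: "s\<^sup>2 = 1" "\<bar>s\<bar> = 1" using assms(1) by auto
  have "coeff_norm 1 P = 2 + 2 * sqrt 2"
    using s2 by (simp add: P_def coeff_norm_1 abs_mult)
  moreover have "sup_norm 1 (Quad (s * (sqrt 2 / 2)) (2 + sqrt 2) (- (s * (sqrt 2 / 2)))) \<le> 1"
    using s2 by (intro sup_norm_1_antisymmetric_le) (simp add: power_mult_distrib power_divide)
  then have "sup_norm 1 P \<le> 1" by (simp add: P_def)
  ultimately show "K2 1 1 = 2 + 2 * sqrt 2" "extremal 1 1 P"
    using K2_eq_and_extremal[OF _ _ admissible_1_1, of P] by auto
qed

lemma extremal_1_infinity:
  assumes "s \<in> {1, -1}" "t \<in> {1, -1}"
  defines "P \<equiv> Quad (s * ((2 + sqrt 2) / 4)) (s * (t * (sqrt 2 / 2))) (s * (- ((2 + sqrt 2) / 4)))"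
  shows "K2 1 \<infinity> = 1 + sqrt 2" "extremal 1 \<infinity> P"
proof -
  have s: "s\<^sup>2 = 1" "\<bar>s\<bar> = 1" "t\<^sup>2 = 1" "\<bar>t\<bar> = 1" using assms(1,2) by auto
  have a: "\<bar>s * ((2 + sqrt 2) / 4)\<bar> = (2 + sqrt 2) / 4" using s by (simp add: abs_mult)
  have "coeff_norm 1 P = 1 + sqrt 2"
    unfolding P_def coeff_norm_1 mult_minus_right abs_minus_cancel a
    using s by (simp add: abs_mult field_simps)
  moreover have "sup_norm \<infinity> (Quad (s * ((2 + sqrt 2) / 4)) (s * (t * (sqrt 2 / 2)))
      (- (s * ((2 + sqrt 2) / 4)))) \<le> 1"
    by (rule sup_norm_infinity_antisymmetric_le, unfold a)
      (use s in \<open>simp add: power_mult_distrib power_divide field_simps\<close>)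
  then have "sup_norm \<infinity> P \<le> 1" by (simp add: P_def)
  ultimately show "K2 1 \<infinity> = 1 + sqrt 2" "extremal 1 \<infinity> P"
    using K2_eq_and_extremal[OF _ _ admissible_1_infinity, of P] by auto
qed

lemma extremal_infinity_1:
  assumes "s \<in> {1, -1}"
  shows "K2 \<infinity> 1 = 4" "extremal \<infinity> 1 (Quad 0 (s * 4) 0)"
proof -
  have s: "\<bar>s\<bar> = 1" using assms by auto
  have "coeff_norm \<infinity> (Quad 0 (s * 4) 0) = 4"
    using s by (simp add: coeff_norm_infinity abs_mult)
  moreover have "sup_norm 1 (Quad 0 (s * 4) 0) \<le> 1"
    using sup_norm_1_antisymmetric_le[of "s * 4" 0] s by (simp add: abs_mult)
  ultimately show "K2 \<infinity> 1 = 4" "extremal \<infinity> 1 (Quad 0 (s * 4) 0)"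
    using K2_eq_and_extremal[OF _ _ admissible_infinity_1] by auto
qed

lemma extremal_infinity_infinity_square:
  assumes "s \<in> {1, -1}"
  shows "K2 \<infinity> \<infinity> = 1" "extremal \<infinity> \<infinity> (Quad s 0 0)" "extremal \<infinity> \<infinity> (Quad 0 0 s)"
proof -
  have s: "\<bar>s\<bar> = 1" using assms by auto
  then have "coeff_norm \<infinity> (Quad s 0 0) = 1" "coeff_norm \<infinity> (Quad 0 0 s) = 1"
    by (simp_all add: coeff_norm_infinity)
  moreover have "sup_norm \<infinity> (Quad s 0 0) \<le> 1" "sup_norm \<infinity> (Quad 0 0 s) \<le> 1"
    using sup_norm_le_coeff_sum[of \<infinity> s 0 0] sup_norm_le_coeff_sum[of \<infinity> 0 0 s] s by auto
  ultimately
  show "K2 \<infinity> \<infinity> = 1" "extremal \<infinity> \<infinity> (Quad s 0 0)" "extremal \<infinity> \<infinity> (Quad 0 0 s)"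
    using K2_eq_and_extremal[OF _ _ admissible_infinity_infinity] by auto
qed

lemma extremal_infinity_infinity_mixed:
  assumes "s \<in> {1, -1}" "t \<in> {1, -1}"
  shows "extremal \<infinity> \<infinity> (Quad (s * (1 / 2)) (s * t) (s * (- (1 / 2))))"
proof -
  have s: "s\<^sup>2 = 1" "\<bar>s\<bar> = 1" "t\<^sup>2 = 1" "\<bar>t\<bar> = 1" using assms by auto
  have "coeff_norm \<infinity> (Quad (s * (1 / 2)) (s * t) (s * (- (1 / 2)))) = 1"
    using s by (simp add: coeff_norm_infinity abs_mult)
  moreover have "sup_norm \<infinity> (Quad (s * (1 / 2)) (s * t) (s * (- (1 / 2)))) \<le> 1"
    using sup_norm_infinity_antisymmetric_le[of "s * t" "s * (1 / 2)"] s
    by (simp add: abs_mult power_mult_distrib)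
  ultimately show ?thesis
    using K2_eq_and_extremal[OF _ _ admissible_infinity_infinity] by auto
qed

theorem theorem2p4:
  "K2 1 1 = 2 + 2 * sqrt 2
   \<and> K2 1 \<infinity> = 1 + sqrt 2
   \<and> K2 \<infinity> 1 = 4
   \<and> K2 \<infinity> \<infinity> = 1
   \<and> (\<forall>s\<in>{1, -1}. extremal 1 1 (Quad (s * (sqrt 2 / 2)) (2 + sqrt 2) (- s * (sqrt 2 / 2))))
   \<and> (\<forall>s\<in>{1, -1}. \<forall>t\<in>{1, -1}.
           extremal 1 \<infinity> (Quad (s * ((2 + sqrt 2) / 4)) (s * (t * (sqrt 2 / 2))) (s * (- ((2 + sqrt 2) / 4)))))
   \<and> (\<forall>s\<in>{1, -1}. extremal \<infinity> 1 (Quad 0 (s * 4) 0))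
   \<and> (\<forall>s\<in>{1, -1}. extremal \<infinity> \<infinity> (Quad s 0 0))
   \<and> (\<forall>s\<in>{1, -1}. extremal \<infinity> \<infinity> (Quad 0 0 s))
   \<and> (\<forall>s\<in>{1, -1}. \<forall>t\<in>{1, -1}. extremal \<infinity> \<infinity> (Quad (s * (1 / 2)) (s * t) (s * (- (1 / 2)))))"
proof (intro conjI ballI)
  show "K2 1 1 = 2 + 2 * sqrt 2" "K2 1 \<infinity> = 1 + sqrt 2" "K2 \<infinity> 1 = 4" "K2 \<infinity> \<infinity> = 1"
    by (rule extremal_1_1(1)[of 1] extremal_1_infinity(1)[of 1 1] extremal_infinity_1(1)[of 1]
        extremal_infinity_infinity_square(1)[of 1]; simp)+
qed (fact extremal_1_1(2) extremal_1_infinity(2) extremal_infinity_1(2)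
    extremal_infinity_infinity_square(2,3) extremal_infinity_infinity_mixed)+

end
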